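(* Let $A$ be a metric Jordan arc. Then $A$ is bounded turning if and only if there is a weak-quasisymmetric homeomorphism $\varphi\colon [0,1]\to A$.
   Context: A metric Jordan arc is a metric space homeomorphic to $[0,1]$. All metrics are written $|x-y|$; the interval $[0,1]$ carries its usual metric. A metric Jordan arc $A$ is bounded turning if there is a constant $C\ge 1$ such that for each pair of points $x,y\in A$ the subarc $A[x,y]\subset A$ between $x$ and $y$ satisfies $\operatorname{diam}A[x,y]\le C|x-y|$. A homeomorphism $\varphi\colon X\to Y$ of metric spaces is weak-quasisymmetric if there is a constant $H\ge 1$ such that for all $x,y,z\in X$: $|x-y|\le |x-z|$ implies $|\varphi(x)-\varphi(y)|\le H|\varphi(x)-\varphi(z)|$. *)

theory Defs
  imports "HOL-Analysis.Analysis"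
begin

definition metric_jordan_arc :: "'a::metric_space set \<Rightarrow> bool" where
  "metric_jordan_arc A \<longleftrightarrow> A homeomorphic {0..1::real}"

text \<open>
  A parametrization of \<open>A\<close> by the unit interval transports the segment between
  the parameters of \<open>x\<close> and \<open>y\<close> to \<open>A\<close>. By the lemma \<open>subarc_eq\<close> below the
  result does not depend on the parametrization.
\<close>

definition subarc :: "'a::metric_space set \<Rightarrow> 'a \<Rightarrow> 'a \<Rightarrow> 'a set" where
  "subarc A x y =
     (THE S. \<exists>g h. homeomorphism {0..1::real} A g h \<and> S = g ` closed_segment (h x) (h y))"

definition bounded_turning :: "'a::metric_space set \<Rightarrow> bool" where
  "bounded_turning A \<longleftrightarrow>
     (\<exists>C\<ge>1. \<forall>x\<in>A. \<forall>y\<in>A. diameter (subarc A x y) \<le> C * dist x y)"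

definition weak_quasisymmetric_homeomorphism ::
    "'a::metric_space set \<Rightarrow> 'b::metric_space set \<Rightarrow> ('a \<Rightarrow> 'b) \<Rightarrow> bool" where
  "weak_quasisymmetric_homeomorphism X Y \<phi> \<longleftrightarrow>
     (\<exists>\<psi>. homeomorphism X Y \<phi> \<psi>) \<and>
     (\<exists>H\<ge>1. \<forall>x\<in>X. \<forall>y\<in>X. \<forall>z\<in>X.
        dist x y \<le> dist x z \<longrightarrow> dist (\<phi> x) (\<phi> y) \<le> H * dist (\<phi> x) (\<phi> z))"

lemma subarc_param_subset:
  fixes A :: "'a::metric_space set"
  assumes g: "homeomorphism {0..1::real} A g h"
    and g': "homeomorphism {0..1::real} A g' h'"
    and x: "x \<in> A" and y: "y \<in> A"
  shows "g ` closed_segment (h x) (h y) \<subseteq> g' ` closed_segment (h' x) (h' y)"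
proof -
  let ?S = "closed_segment (h' x) (h' y)"
  have mem: "h' x \<in> {0..1}" "h' y \<in> {0..1}"
    using g' x y by (auto simp: homeomorphism_def)
  have S: "?S \<subseteq> {0..1}"
    using mem by (intro closed_segment_subset) auto
  have SA: "g' ` ?S \<subseteq> A"
    using S g' by (auto simp: homeomorphism_def)
  have "continuous_on ?S g'"
    using homeomorphism_cont1[OF g'] S by (rule continuous_on_subset)
  then have "connected (g' ` ?S)"
    by (intro connected_continuous_image) auto
  moreover have "continuous_on (g' ` ?S) h"
    using homeomorphism_cont2[OF g] SA by (rule continuous_on_subset)
  ultimately have conn: "connected (h ` g' ` ?S)"
    by (rule connected_continuous_image[rotated])
  have "x \<in> g' ` ?S"
    using homeomorphism_apply2[OF g' x, symmetric] by (rule image_eqI) simp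
  moreover have "y \<in> g' ` ?S"
    using homeomorphism_apply2[OF g' y, symmetric] by (rule image_eqI) simp
  ultimately have xy: "h x \<in> h ` g' ` ?S" "h y \<in> h ` g' ` ?S"
    by (simp_all only: imageI)
  have "closed_segment (h x) (h y) \<subseteq> h ` g' ` ?S"
  proof (rule closed_segment_subset)
    show "convex (h ` g' ` ?S)"
      using conn by (simp only: connected_convex_1)
  qed (fact xy)+
  then have "g ` closed_segment (h x) (h y) \<subseteq> g ` h ` g' ` ?S"
    by (rule image_mono)
  also have "\<dots> = g' ` ?S"
  proof -
    have "\<And>a. a \<in> g' ` ?S \<Longrightarrow> g (h a) = a"
      using SA homeomorphism_apply2[OF g] by (meson subsetD)
    then show ?thesis
      by (simp add: image_image)
  qed
  finally show ?thesis .
qed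

lemma subarc_eq:
  fixes A :: "'a::metric_space set"
  assumes "homeomorphism {0..1::real} A g h" and "x \<in> A" and "y \<in> A"
  shows "subarc A x y = g ` closed_segment (h x) (h y)"
  unfolding subarc_def
proof (rule the_equality)
  show "\<exists>g' h'. homeomorphism {0..1::real} A g' h' \<and>
      g ` closed_segment (h x) (h y) = g' ` closed_segment (h' x) (h' y)"
    using assms by blast
next
  fix S
  assume "\<exists>g' h'. homeomorphism {0..1::real} A g' h' \<and> S = g' ` closed_segment (h' x) (h' y)"
  then show "S = g ` closed_segment (h x) (h y)"
    using subarc_param_subset[OF _ assms(1)] subarc_param_subset[OF assms(1)] assms(2,3)
    by (elim exE conjE) (simp add: subset_antisym)
qed

end

theory Submission
  imports Defs
begin

text \<open>
  If \<open>\<phi>\<close> is weak-quasisymmetric with constant \<open>H\<close>, then every point of the subarc between \<open>x\<close> and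
  \<open>y\<close> is within \<open>H * dist x y\<close> of \<open>x\<close>, since its parameter is at least as close to that of \<open>x\<close> as
  the parameter of \<open>y\<close> is; so \<open>2 * H\<close> is a bounded turning constant.

  Conversely, fix a parametrization \<open>g\<close> of a bounded turning arc and measure a parameter interval
  by the size \<open>d s t = diameter (g ` {s..t})\<close>, which is comparable to \<open>dist (g s) (g t)\<close>. It
  suffices to find an increasing homeomorphism \<open>F\<close> of \<open>[0,1]\<close> (below: \<open>param\<close>) such that
  \<open>\<bar>F x - F y\<bar> \<le> \<bar>F x - F z\<bar>\<close> bounds the size of the segment between \<open>x\<close> and \<open>y\<close> by a constant
  times that of the segment between \<open>x\<close> and \<open>z\<close>; then \<open>g\<close> composed with the inverse of \<open>F\<close> is
  weak-quasisymmetric. The function \<open>F\<close> is the distribution function of a measure on \<open>[0,1]\<close>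
  built as a cascade. At level \<open>n\<close> the interval is divided into nodes whose size lies between
  \<open>mesh n\<close> and \<open>2 * mesh n\<close>, where \<open>mesh n = d 0 1 / 128 ^ n\<close>, and every node has a weight such
  that

  \<^item> neighbouring nodes of the same level have weights within a factor 2 of each other;
  \<^item> a node of level \<open>n + 1\<close> has at most an eighth of the weight of its parent.

  The number of children of a node cannot be bounded, and two neighbouring nodes may have very
  different numbers of children. A node of weight \<open>a\<close> therefore does not split its weight evenly:
  the children at its two ends get between \<open>a / 32\<close> and \<open>a / 8\<close>, adjusted to the neighbours, and
  from there the weights decrease geometrically to a constant (\<open>child_weights\<close>).

  Suppose that the segment from \<open>x\<close> to \<open>y\<close> is much larger than the segment from \<open>x\<close> to \<open>z\<close>. Let
  \<open>m\<close> be the first level at which four meshes fit into the former, let \<open>Y\<close> be a node of level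
  \<open>m + 1\<close> containing \<open>x\<close>, and let \<open>X\<close> be its parent. The long segment contains a neighbour of \<open>X\<close>,
  so \<open>\<bar>F x - F y\<bar>\<close> is at least half the weight of \<open>X\<close> (\<open>param_diff_lower\<close>). The short segment
  lies in the union of \<open>Y\<close> and one neighbour, so \<open>\<bar>F x - F z\<bar>\<close> is at most three times the weight
  of \<open>Y\<close> (\<open>param_diff_upper\<close>), hence at most three eighths of the weight of \<open>X\<close>. Thus
  \<open>\<bar>F x - F z\<bar> < \<bar>F x - F y\<bar>\<close>. The same two estimates show that \<open>F\<close> is continuous and strictly
  increasing.
\<close>

section \<open>Distributing a weight over a row of children\<close>

text \<open>
  The prescribed end weights \<open>l\<close> and \<open>r\<close> are attained up to a factor 2. The solution is a sum of
  two geometric sequences, decreasing from the left and from the right end, and a constant \<open>c\<close>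
  that fixes the total. As each summand changes by at most a factor 2 from one index to the next,
  so does the sum.
\<close>

lemma child_weights:
  fixes a l r :: real and N :: nat
  assumes N: "64 \<le> N" and a: "0 < a"
    and l: "a / 32 \<le> l" "l \<le> a / 16" and r: "a / 32 \<le> r" "r \<le> a / 16"
  shows "\<exists>w. (\<Sum>j<N. w j) = a \<and> (\<forall>j<N. 0 < w j \<and> w j \<le> a / 8) \<and>
    (\<forall>j. Suc j < N \<longrightarrow> w j \<le> 2 * w (Suc j) \<and> w (Suc j) \<le> 2 * w j) \<and>
    l \<le> w 0 \<and> w 0 \<le> 2 * l \<and> r \<le> w (N - 1) \<and> w (N - 1) \<le> 2 * r"
proof -
  define c where "c = (a - (l + r) * (\<Sum>j<N. (1/2) ^ j)) / N"
  define w where "w j = l * (1/2) ^ j + r * (1/2) ^ (N - 1 - j) + c" for j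
  have geo: "(\<Sum>j<N. (1/2) ^ j) = 2 - 2 * (1/2 :: real) ^ N"
    by (induction N) auto
  have "(l + r) * (\<Sum>j<N. (1/2) ^ j) \<le> (a / 8) * 2"
    using l r a by (intro mult_mono) (auto simp: geo power_le_one)
  moreover have "0 \<le> (l + r) * (\<Sum>j<N. (1/2) ^ j)"
    using l r a by (intro mult_nonneg_nonneg sum_nonneg) auto
  ultimately have c: "0 < c" "c \<le> a / N"
    using N a by (auto simp: c_def intro!: divide_right_mono divide_pos_pos)
  have "a / N \<le> a / 64"
    using N a by (intro divide_left_mono) auto
  with c have c64: "c \<le> a / 64" by linarith
  have pow_le: "(1/2 :: real) ^ (N - 1) \<le> 1 / 4"
    using power_decreasing[of 2 "N - 1" "1/2 :: real"] N by (simp add: power2_eq_square)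
  have l_le: "l * (1/2) ^ (N - 1) \<le> (a / 16) * (1 / 4)" and r_le: "r * (1/2) ^ (N - 1) \<le> (a / 16) * (1 / 4)"
    using l r a pow_le by (intro mult_mono; simp)+
  have nonneg: "0 \<le> l * (1/2) ^ i" "0 \<le> r * (1/2) ^ i" for i
    using l r a by auto
  have reflect: "(\<Sum>j<N. (1/2) ^ (N - 1 - j)) = (\<Sum>j<N. (1/2 :: real) ^ j)"
    using sum.nat_diff_reindex[of "\<lambda>j. (1/2 :: real) ^ j" N] by simp
  have "(\<Sum>j<N. w j) = l * (\<Sum>j<N. (1/2) ^ j) + r * (\<Sum>j<N. (1/2) ^ (N - 1 - j)) + N * c"
    by (simp add: w_def sum.distrib sum_distrib_left)
  also have "\<dots> = a"
  proof -
    have "N * c = a - (l + r) * (\<Sum>j<N. (1/2) ^ j)"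
      using N by (simp add: c_def)
    then show ?thesis
      unfolding reflect by (simp add: algebra_simps)
  qed
  finally have total: "(\<Sum>j<N. w j) = a" .
  have pos: "0 < w j" for j
    using nonneg[of j] nonneg[of "N - 1 - j"] c by (simp add: w_def)
  have upper: "w j \<le> a / 8" if "j < N" for j
  proof -
    have half: "x * (1/2) ^ i \<le> a / 32" if "x \<le> a / 16" "1 \<le> i" for x and i :: nat
    proof -
      have "x * (1/2) ^ i \<le> (a / 16) * (1/2) ^ i"
        using that by (intro mult_right_mono) auto
      also have "\<dots> \<le> (a / 16) * (1/2)"
        using power_decreasing[of 1 i "1/2 :: real"] that a by (intro mult_left_mono) auto
      finally show ?thesis by simp
    qed
    have one: "x * (1/2) ^ i \<le> a / 16" if "0 \<le> x" "x \<le> a / 16" for x and i :: nat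
      using mult_left_mono[of "(1/2) ^ i" 1 x] that power_le_one[of "1/2 :: real" i] by simp
    have lr: "0 \<le> l" "0 \<le> r" using l r a by auto
    have "1 \<le> j \<or> 1 \<le> N - 1 - j" using N by linarith
    then have "l * (1/2) ^ j + r * (1/2) ^ (N - 1 - j) \<le> a / 16 + a / 32"
      using half[of l j] half[of r "N - 1 - j"] one[of l j] one[of r "N - 1 - j"] l r lr by linarith
    then show ?thesis using c64 a by (simp add: w_def)
  qed
  have ratio: "w j \<le> 2 * w (Suc j) \<and> w (Suc j) \<le> 2 * w j" if "Suc j < N" for j
  proof -
    have "N - 1 - j = Suc (N - 1 - Suc j)" using that by simp
    then have "w j = l * (1/2) ^ j + r * ((1/2) ^ (N - 1 - Suc j) / 2) + c"
      by (simp add: w_def)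
    moreover have "w (Suc j) = l * ((1/2) ^ j / 2) + r * (1/2) ^ (N - 1 - Suc j) + c"
      by (simp add: w_def)
    ultimately show ?thesis
      using nonneg[of j] nonneg[of "N - 1 - Suc j"] c by simp
  qed
  have "l \<le> w 0" "w 0 \<le> 2 * l"
    using nonneg(2)[of "N - 1"] c c64 r_le l a by (simp_all add: w_def)
  moreover have "r \<le> w (N - 1)" "w (N - 1) \<le> 2 * r"
    using nonneg(1)[of "N - 1"] c c64 l_le r a by (simp_all add: w_def)
  ultimately show ?thesis
    using total pos upper ratio by (intro exI[of _ w]) auto
qed

section \<open>Knots\<close>

text \<open>
  An end point of nodes: its position in \<open>[0,1]\<close>, the value there of the distribution function
  under construction, and a number \<open>local_weight\<close> that prescribes, up to a factor 2, the weights
  of the two nodes that meet at this knot. At level \<open>n\<close> the prescribed weight is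
  \<open>local_weight / 16 ^ n\<close>; with this normalization a knot persists unchanged at all later levels,
  and two neighbouring nodes can be subdivided independently of each other.
\<close>

datatype knot = Knot (pos: real) (val: real) (local_weight: real)

text \<open>Knots that come from the cascade below are linearly ordered, by position and by value alike.\<close>

definition before :: "knot \<Rightarrow> knot \<Rightarrow> bool" where
  "before x y \<longleftrightarrow> pos x < pos y \<and> val x < val y"

definition before_eq :: "knot \<Rightarrow> knot \<Rightarrow> bool" where
  "before_eq x y \<longleftrightarrow> x = y \<or> before x y"

lemma before_eq_imp_le: "before_eq x y \<Longrightarrow> pos x \<le> pos y \<and> val x \<le> val y"
  by (auto simp: before_eq_def before_def)

lemma before_eq_refl [simp]: "before_eq x x"
  by (simp add: before_eq_def)

lemma before_eq_trans: "before_eq x y \<Longrightarrow> before_eq y z \<Longrightarrow> before_eq x z"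
  by (auto simp: before_eq_def before_def)

section \<open>Subadditive interval sizes\<close>

text \<open>
  A size \<open>d s t\<close> of the intervals \<open>{s..t}\<close> in \<open>[0,1]\<close>, modelled on the diameter of a subarc. Only
  its values for \<open>s \<le> t\<close> matter.
\<close>

locale arc_size =
  fixes d :: "real \<Rightarrow> real \<Rightarrow> real"
  assumes size_mono: "\<lbrakk>0 \<le> s; s \<le> s'; s' \<le> t'; t' \<le> t; t \<le> 1\<rbrakk> \<Longrightarrow> d s' t' \<le> d s t"
    and size_triangle: "\<lbrakk>0 \<le> s; s \<le> t; t \<le> u; u \<le> 1\<rbrakk> \<Longrightarrow> d s u \<le> d s t + d t u"
    and size_small: "0 < e \<Longrightarrow> \<exists>\<eta>>0. \<forall>s t. 0 \<le> s \<longrightarrow> s \<le> t \<longrightarrow> t \<le> 1 \<longrightarrow> t - s < \<eta> \<longrightarrow> d s t < e"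
    and size_pos: "\<lbrakk>0 \<le> s; s < t; t \<le> 1\<rbrakk> \<Longrightarrow> 0 < d s t"
begin

lemma size_refl: "\<lbrakk>0 \<le> s; s \<le> 1\<rbrakk> \<Longrightarrow> d s s = 0"
proof -
  assume s: "0 \<le> s" "s \<le> 1"
  have "d s s < e" if "0 < e" for e
    using size_small[OF that] s by fastforce
  then have "d s s \<le> 0" by (meson less_irrefl not_le)
  moreover have "0 \<le> d s s" using size_triangle[of s s s] s by simp
  ultimately show ?thesis by simp
qed

lemma size_continuous:
  assumes "0 \<le> a" "b \<le> 1"
  shows "continuous_on {a..b} (d a)"
  unfolding continuous_on_iff
proof (intro ballI allI impI)
  fix t e :: real
  assume t: "t \<in> {a..b}" and "0 < e"
  then obtain \<eta> where \<eta>: "0 < \<eta>" "\<And>s t. \<lbrakk>0 \<le> s; s \<le> t; t \<le> 1; t - s < \<eta>\<rbrakk> \<Longrightarrow> d s t < e"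
    using size_small by blast
  have ordered: "\<bar>d a v - d a u\<bar> < e" if "a \<le> u" "u \<le> v" "v \<le> b" "v - u < \<eta>" for u v
    using size_mono[of a a u v] size_triangle[of a u v] \<eta>(2)[of u v] that assms by simp
  show "\<exists>\<delta>>0. \<forall>s\<in>{a..b}. dist s t < \<delta> \<longrightarrow> dist (d a s) (d a t) < e"
  proof (intro exI[of _ \<eta>] conjI ballI impI \<eta>(1))
    fix s assume "s \<in> {a..b}" "dist s t < \<eta>"
    then show "dist (d a s) (d a t) < e"
      using ordered[of s t] ordered[of t s] t
      by (cases "s \<le> t") (auto simp: dist_real_def abs_minus_commute)
  qed
qed

text \<open>
  Pieces of size exactly \<open>r\<close> are cut off from the left as long as the rest has size more than
  \<open>2 * r\<close>; by subadditivity the rest never has size less than \<open>r\<close>. The procedure stops because a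
  piece of size \<open>r\<close> has at least some fixed length \<open>\<eta>\<close>.
\<close>

lemma division:
  assumes "0 \<le> a" "a < b" "b \<le> 1" "0 < r" "r \<le> d a b"
  shows "\<exists>N p. 0 < N \<and> p 0 = a \<and> p N = b \<and>
    (\<forall>j<N. p j < p (Suc j) \<and> r \<le> d (p j) (p (Suc j)) \<and> d (p j) (p (Suc j)) \<le> 2 * r)"
proof -
  obtain \<eta> where \<eta>: "0 < \<eta>" "\<And>s t. \<lbrakk>0 \<le> s; s \<le> t; t \<le> 1; t - s < \<eta>\<rbrakk> \<Longrightarrow> d s t < r"
    using size_small[OF assms(4)] by blast
  obtain m :: nat where "b - a \<le> m * \<eta>"
    using reals_Archimedean3[OF \<eta>(1)] by (meson less_imp_le)
  then show ?thesis
    using assms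
  proof (induction m arbitrary: a)
    case 0
    then show ?case by simp
  next
    case (Suc m)
    show ?case
    proof (cases "d a b \<le> 2 * r")
      case True
      then show ?thesis
        using Suc.prems by (intro exI[of _ 1] exI[of _ "\<lambda>j. if j = 0 then a else b"]) auto
    next
      case False
      have "\<exists>c\<ge>a. c \<le> b \<and> d a c = r"
        using False Suc.prems size_refl[of a] size_continuous[of a b]
        by (intro IVT') auto
      then obtain c where c: "a \<le> c" "c \<le> b" "d a c = r" by blast
      have "\<eta> \<le> c - a"
        using \<eta>(2)[of a c] c Suc.prems by force
      moreover have "r < d c b"
        using size_triangle[of a c b] c False Suc.prems by simp
      moreover from this have "c < b"
        using c size_refl[of b] Suc.prems by (cases "c = b") auto
      ultimately obtain N p where p: "0 < N" "p 0 = c" "p N = b"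
        "\<forall>j<N. p j < p (Suc j) \<and> r \<le> d (p j) (p (Suc j)) \<and> d (p j) (p (Suc j)) \<le> 2 * r"
        using Suc.IH[of c] Suc.prems c by (auto simp: algebra_simps)
      define p' where "p' j = (case j of 0 \<Rightarrow> a | Suc i \<Rightarrow> p i)" for j
      have "\<forall>j<Suc N. p' j < p' (Suc j) \<and> r \<le> d (p' j) (p' (Suc j)) \<and> d (p' j) (p' (Suc j)) \<le> 2 * r"
        using p c \<open>\<eta> \<le> c - a\<close> \<eta>(1) Suc.prems by (auto simp: p'_def split: nat.split)
      then show ?thesis
        using p(3) by (intro exI[of _ "Suc N"] exI[of _ p']) (auto simp: p'_def)
    qed
  qed
qed

section \<open>Nodes and their subdivision\<close>

text \<open>The length scale of level \<open>n\<close>.\<close>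

definition mesh :: "nat \<Rightarrow> real" where
  "mesh n = d 0 1 / 128 ^ n"

lemma mesh_pos: "0 < mesh n"
  using size_pos[of 0 1] by (simp add: mesh_def)

lemma mesh_Suc: "mesh n = 128 * mesh (Suc n)"
  by (simp add: mesh_def)

lemma mesh_small: "0 < e \<Longrightarrow> \<exists>n. mesh n < e"
proof -
  assume "0 < e"
  then obtain n where "(1/128) ^ n < e / d 0 1"
    using real_arch_pow_inv[of "e / d 0 1" "1/128"] size_pos[of 0 1] by auto
  then show ?thesis
    using size_pos[of 0 1] by (intro exI[of _ n]) (simp add: mesh_def field_simps)
qed

text \<open>
  The pair \<open>(a, b)\<close> of knots is admissible as a node of level \<open>n\<close>: its interval is
  \<open>{pos a..pos b}\<close>, its weight is \<open>val b - val a\<close>.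
\<close>

definition node :: "nat \<Rightarrow> knot \<Rightarrow> knot \<Rightarrow> bool" where
  "node n a b \<longleftrightarrow> 0 \<le> pos a \<and> pos a < pos b \<and> pos b \<le> 1 \<and>
     mesh n \<le> d (pos a) (pos b) \<and> d (pos a) (pos b) \<le> 2 * mesh n \<and>
     val a < val b \<and>
     (\<forall>c\<in>{a, b}. (val b - val a) / 2 \<le> local_weight c / 16 ^ n \<and> local_weight c / 16 ^ n \<le> val b - val a)"

text \<open>
  \<open>C\<close> is the edge set of a chain of nodes of level \<open>n + 1\<close> that leads from \<open>a\<close> to \<open>b\<close>. The chain
  is described only through what is needed of it: each edge is small, lies between \<open>a\<close> and \<open>b\<close> and
  continues to both sides, the edges are linearly ordered, and their intervals cover
  \<open>{pos a..pos b}\<close>.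
\<close>

definition subdivision :: "nat \<Rightarrow> knot \<Rightarrow> knot \<Rightarrow> (knot \<times> knot) set \<Rightarrow> bool" where
  "subdivision n a b C \<longleftrightarrow>
     (\<forall>(x, y)\<in>C. node (Suc n) x y \<and> before_eq a x \<and> before_eq y b \<and>
        val y - val x \<le> (val b - val a) / 8 \<and>
        (x = a \<or> (\<exists>z. (z, x) \<in> C)) \<and> (y = b \<or> (\<exists>z. (y, z) \<in> C))) \<and>
     (\<exists>y. (a, y) \<in> C) \<and> (\<exists>x. (x, b) \<in> C) \<and>
     (\<forall>(x, y)\<in>C. \<forall>(x', y')\<in>C. (x, y) = (x', y') \<or> before_eq y x' \<or> before_eq y' x) \<and>
     (\<forall>t. pos a \<le> t \<longrightarrow> t \<le> pos b \<longrightarrow> (\<exists>(x, y)\<in>C. pos x \<le> t \<and> t \<le> pos y))"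

lemma subdivision_member:
  assumes "subdivision n a b C" "(x, y) \<in> C"
  shows "node (Suc n) x y" "before_eq a x" "before_eq y b" "val y - val x \<le> (val b - val a) / 8"
    "x = a \<or> (\<exists>z. (z, x) \<in> C)" "y = b \<or> (\<exists>z. (y, z) \<in> C)"
  using bspec[OF conjunct1[OF assms(1)[unfolded subdivision_def]] assms(2)] by simp_all

lemma subdivision_linear:
  assumes "subdivision n a b C" "(x, y) \<in> C" "(x', y') \<in> C"
  shows "(x, y) = (x', y') \<or> before_eq y x' \<or> before_eq y' x"
proof -
  have "\<forall>(x, y)\<in>C. \<forall>(x', y')\<in>C. (x, y) = (x', y') \<or> before_eq y x' \<or> before_eq y' x"
    using assms(1) unfolding subdivision_def by (elim conjE)
  from bspec[OF this assms(2)] assms(3) show ?thesis by (auto dest: bspec)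
qed

lemma subdivision_ends:
  assumes "subdivision n a b C"
  shows "\<exists>y. (a, y) \<in> C" "\<exists>x. (x, b) \<in> C"
  using assms by (simp_all only: subdivision_def)

lemma subdivision_cover:
  assumes "subdivision n a b C" "pos a \<le> t" "t \<le> pos b"
  shows "\<exists>x y. (x, y) \<in> C \<and> pos x \<le> t \<and> t \<le> pos y"
proof -
  have "\<exists>(x, y)\<in>C. pos x \<le> t \<and> t \<le> pos y"
    using assms by (simp only: subdivision_def)
  then show ?thesis by blast
qed

lemma node_imp_before: "node n a b \<Longrightarrow> before a b"
  by (simp add: node_def before_def)

lemma subdivision_exists:
  assumes ab: "node n a b"
  shows "\<exists>C. subdivision n a b C"
proof -
  let ?r = "mesh (Suc n)"
  have dab: "128 * ?r \<le> d (pos a) (pos b)" and pab: "0 \<le> pos a" "pos a < pos b" "pos b \<le> 1"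
    using ab mesh_Suc[of n] by (auto simp: node_def)
  have "?r \<le> d (pos a) (pos b)"
    using dab mesh_pos[of "Suc n"] by simp
  then obtain N p where p: "0 < N" "p 0 = pos a" "p N = pos b"
    "\<And>j. j < N \<Longrightarrow> p j < p (Suc j)"
    "\<And>j. j < N \<Longrightarrow> ?r \<le> d (p j) (p (Suc j))" "\<And>j. j < N \<Longrightarrow> d (p j) (p (Suc j)) \<le> 2 * ?r"
    using division[OF pab mesh_pos[of "Suc n"]] by auto
  have p_mono: "p i \<le> p j" if "i \<le> j" "j \<le> N" for i j
    using that
  proof (induction rule: dec_induct)
    case (step k)
    then show ?case using p(4)[of k] by simp
  qed simp
  have "d (p 0) (p k) \<le> 2 * ?r * k" if "k \<le> N" for k
    using that
  proof (induction k)
    case 0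
    then show ?case using size_refl p pab by simp
  next
    case (Suc k)
    then have "d (p 0) (p (Suc k)) \<le> d (p 0) (p k) + d (p k) (p (Suc k))"
      using p_mono[of 0 k] p_mono[of k "Suc k"] p_mono[of "Suc k" N] p(2,3) pab
      by (intro size_triangle) auto
    then show ?case using Suc p(6)[of k] by (simp add: algebra_simps)
  qed
  from this[of N] have "64 * (2 * ?r) \<le> N * (2 * ?r)"
    using dab p(2,3) by (simp add: algebra_simps)
  \<comment> \<open>A node of size at least \<open>128 * ?r\<close> has at least 64 children of size at most \<open>2 * ?r\<close>.\<close>
  then have N: "64 \<le> N"
    using mesh_pos[of "Suc n"] by simp
  obtain w where w: "(\<Sum>j<N. w j) = val b - val a"
    "\<And>j. j < N \<Longrightarrow> 0 < w j" "\<And>j. j < N \<Longrightarrow> w j \<le> (val b - val a) / 8"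
    "\<And>j. Suc j < N \<Longrightarrow> w j \<le> 2 * w (Suc j)" "\<And>j. Suc j < N \<Longrightarrow> w (Suc j) \<le> 2 * w j"
    "local_weight a / 16 ^ Suc n \<le> w 0" "w 0 \<le> 2 * (local_weight a / 16 ^ Suc n)"
    "local_weight b / 16 ^ Suc n \<le> w (N - 1)" "w (N - 1) \<le> 2 * (local_weight b / 16 ^ Suc n)"
  proof -
    have "val a < val b"
      "(val b - val a) / 32 \<le> local_weight a / 16 ^ Suc n" "local_weight a / 16 ^ Suc n \<le> (val b - val a) / 16"
      "(val b - val a) / 32 \<le> local_weight b / 16 ^ Suc n" "local_weight b / 16 ^ Suc n \<le> (val b - val a) / 16"
      using ab by (auto simp: node_def field_simps)
    with child_weights[OF N, of "val b - val a" "local_weight a / 16 ^ Suc n" "local_weight b / 16 ^ Suc n"]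
    show ?thesis
      using that by (metis diff_gt_0_iff_gt)
  qed
  \<comment> \<open>A new interior knot prescribes the smaller of the two adjacent weights; since these differ by
    at most a factor 2, it is admissible for both nodes.\<close>
  define \<kappa> where "\<kappa> j = (if j = 0 then local_weight a else if j = N then local_weight b
    else 16 ^ Suc n * min (w (j - 1)) (w j))" for j
  define x where "x j = Knot (p j) (val a + (\<Sum>i<j. w i)) (\<kappa> j)" for j
  have x0: "x 0 = a" and xN: "x N = b"
    using p(1-3) w(1) by (simp_all add: x_def \<kappa>_def)
  have step: "before (x j) (x (Suc j))" if "j < N" for j
    using p(4) w(2) that by (simp add: before_def x_def)
  have mono: "before_eq (x i) (x j)" if "i \<le> j" "j \<le> N" for i j
    using that
  proof (induction rule: dec_induct)
    case (step k)
    then show ?case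
      using \<open>\<And>j. j < N \<Longrightarrow> before (x j) (x (Suc j))\<close>[of k] before_eq_trans[of "x i" "x k"]
      by (simp add: before_eq_def)
  qed simp
  have weight_left: "w j / 2 \<le> \<kappa> j / 16 ^ Suc n \<and> \<kappa> j / 16 ^ Suc n \<le> w j" if "j < N" for j
  proof (cases j)
    case 0
    then show ?thesis using w(6,7) by (simp add: \<kappa>_def)
  next
    case (Suc i)
    then have "\<kappa> j / 16 ^ Suc n = min (w i) (w j)" using that by (simp add: \<kappa>_def)
    then show ?thesis using w(2)[of j] w(5)[of i] that Suc by (simp add: min_def)
  qed
  have weight_right: "w j / 2 \<le> \<kappa> (Suc j) / 16 ^ Suc n \<and> \<kappa> (Suc j) / 16 ^ Suc n \<le> w j" if "j < N" for j
  proof (cases "Suc j = N")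
    case True
    then have "j = N - 1" by simp
    with True show ?thesis using w(8,9) by (simp add: \<kappa>_def)
  next
    case False
    then have "\<kappa> (Suc j) / 16 ^ Suc n = min (w j) (w (Suc j))" using that by (simp add: \<kappa>_def)
    then show ?thesis using w(2)[of j] w(4)[of j] that False by (simp add: min_def)
  qed
  have nodes: "node (Suc n) (x j) (x (Suc j))" if "j < N" for j
    using that p(4-6)[OF that] w(2)[OF that] p_mono[of 0 j] p_mono[of "Suc j" N] p(2,3) pab
      weight_left[OF that] weight_right[OF that]
    unfolding node_def by (simp add: x_def)
  have cover: "\<exists>j<N. p j \<le> t \<and> t \<le> p (Suc j)" if "pos a \<le> t" "t \<le> pos b" for t
  proof -
    have "\<exists>j<k. p j \<le> t \<and> t \<le> p (Suc j)" if "t \<le> p k" "0 < k" for k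
      using that
    proof (induction k)
      case (Suc k)
      show ?case
      proof (cases "t \<le> p k \<and> 0 < k")
        case True
        then show ?thesis using Suc.IH less_SucI by blast
      next
        case False
        then have "p k \<le> t" using \<open>pos a \<le> t\<close> p(2) by (cases k) auto
        then show ?thesis using Suc.prems by blast
      qed
    qed simp
    then show ?thesis using that p(1,3) by simp
  qed
  let ?C = "(\<lambda>j. (x j, x (Suc j))) ` {..<N}"
  have "subdivision n a b ?C"
    unfolding subdivision_def
  proof (intro conjI)
    have left: "x j = a \<or> (\<exists>z. (z, x j) \<in> ?C)" if "j < N" for j
    proof (cases j)
      case 0
      then show ?thesis using x0 by simp
    next
      case (Suc i)
      then have "(x i, x j) \<in> ?C" using that by force
      then show ?thesis by blast
    qed
    have right: "x (Suc j) = b \<or> (\<exists>z. (x (Suc j), z) \<in> ?C)" if "j < N" for j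
    proof (cases "Suc j = N")
      case True
      then show ?thesis using xN by simp
    next
      case False
      then have "(x (Suc j), x (Suc (Suc j))) \<in> ?C" using that by force
      then show ?thesis by blast
    qed
    show "\<forall>(x, y)\<in>?C. node (Suc n) x y \<and> before_eq a x \<and> before_eq y b \<and>
        val y - val x \<le> (val b - val a) / 8 \<and>
        (x = a \<or> (\<exists>z. (z, x) \<in> ?C)) \<and> (y = b \<or> (\<exists>z. (y, z) \<in> ?C))"
    proof (clarify)
      fix j assume j: "j < N"
      have "val (x (Suc j)) - val (x j) \<le> (val b - val a) / 8"
        using w(3)[OF j] by (simp add: x_def)
      then show "node (Suc n) (x j) (x (Suc j)) \<and> before_eq a (x j) \<and> before_eq (x (Suc j)) b \<and>
        val (x (Suc j)) - val (x j) \<le> (val b - val a) / 8 \<and>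
        (x j = a \<or> (\<exists>z. (z, x j) \<in> ?C)) \<and> (x (Suc j) = b \<or> (\<exists>z. (x (Suc j), z) \<in> ?C))"
        using nodes[OF j] mono[of 0 j] mono[of "Suc j" N] j left[OF j] right[OF j] x0 xN by simp
    qed
    have "(x 0, x (Suc 0)) \<in> ?C" using p(1) by blast
    then show "\<exists>y. (a, y) \<in> ?C" using x0 by auto
    have "(x (N - 1), x (Suc (N - 1))) \<in> ?C" using p(1) by (intro image_eqI[of _ _ "N - 1"]) auto
    then show "\<exists>y. (y, b) \<in> ?C" using xN p(1) by auto
    have "x i = x j \<and> x (Suc i) = x (Suc j) \<or> before_eq (x (Suc i)) (x j) \<or> before_eq (x (Suc j)) (x i)"
      if "i < N" "j < N" for i j
      using that mono[of "Suc i" j] mono[of "Suc j" i] by (cases i j rule: linorder_cases) auto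
    then show "\<forall>(x, y)\<in>?C. \<forall>(x', y')\<in>?C. (x, y) = (x', y') \<or> before_eq y x' \<or> before_eq y' x"
      by auto
    show "\<forall>t. pos a \<le> t \<longrightarrow> t \<le> pos b \<longrightarrow> (\<exists>(x, y)\<in>?C. pos x \<le> t \<and> t \<le> pos y)"
    proof (intro allI impI)
      fix t assume "pos a \<le> t" "t \<le> pos b"
      then obtain j where "j < N" "p j \<le> t" "t \<le> p (Suc j)" using cover by blast
      then show "\<exists>(x, y)\<in>?C. pos x \<le> t \<and> t \<le> pos y"
        by (intro bexI[of _ "(x j, x (Suc j))"]) (auto simp: x_def)
    qed
  qed
  then show ?thesis by blast
qed

section \<open>The cascade of nodes\<close>

definition children :: "nat \<Rightarrow> knot \<Rightarrow> knot \<Rightarrow> (knot \<times> knot) set" where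
  "children n a b = (SOME C. subdivision n a b C)"

lemma subdivision_children: "node n a b \<Longrightarrow> subdivision n a b (children n a b)"
  unfolding children_def by (rule someI_ex) (rule subdivision_exists)

text \<open>All nodes of level \<open>n\<close>, starting from the whole interval with weight 1.\<close>

primrec nodes :: "nat \<Rightarrow> (knot \<times> knot) set" where
  "nodes 0 = {(Knot 0 0 1, Knot 1 1 1)}"
| "nodes (Suc n) = (\<Union>(a, b)\<in>nodes n. children n a b)"

lemma node_root: "node 0 (Knot 0 0 1) (Knot 1 1 1)"
  using size_pos[of 0 1] by (simp add: node_def mesh_def)

lemma nodes_node: "(a, b) \<in> nodes n \<Longrightarrow> node n a b"
proof (induction n arbitrary: a b)
  case 0
  then show ?case using node_root by simp
next
  case (Suc n)
  then obtain a' b' where "(a', b') \<in> nodes n" "(a, b) \<in> children n a' b'" by auto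
  then show ?case
    using subdivision_member(1)[OF subdivision_children[OF Suc.IH]] by blast
qed

lemma subdivision_nodes: "(a, b) \<in> nodes n \<Longrightarrow> subdivision n a b (children n a b)"
  by (intro subdivision_children nodes_node)

lemma nodes_SucE:
  assumes "(x, y) \<in> nodes (Suc n)"
  obtains a b where "(a, b) \<in> nodes n" "(x, y) \<in> children n a b" "before_eq a x" "before_eq y b"
    "val y - val x \<le> (val b - val a) / 8"
proof -
  obtain a b where ab: "(a, b) \<in> nodes n" "(x, y) \<in> children n a b" using assms by auto
  then show thesis
    using that[OF ab] subdivision_member(2-4)[OF subdivision_nodes[OF ab(1)] ab(2)] by blast
qed

lemma nodes_weight: "(a, b) \<in> nodes n \<Longrightarrow> val b - val a \<le> (1/8) ^ n"
proof (induction n arbitrary: a b)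
  case (Suc n)
  obtain a' b' where "(a', b') \<in> nodes n" "val b - val a \<le> (val b' - val a') / 8"
    using Suc.prems by (rule nodes_SucE)
  with Suc.IH[of a' b'] show ?case by simp
qed simp

lemma nodes_linear:
  "\<lbrakk>(x, y) \<in> nodes n; (x', y') \<in> nodes n\<rbrakk> \<Longrightarrow> (x, y) = (x', y') \<or> before_eq y x' \<or> before_eq y' x"
proof (induction n arbitrary: x y x' y')
  case (Suc n)
  obtain a b where ab: "(a, b) \<in> nodes n" "(x, y) \<in> children n a b" "before_eq a x" "before_eq y b"
    using Suc.prems(1) by (rule nodes_SucE)
  obtain a' b' where ab': "(a', b') \<in> nodes n" "(x', y') \<in> children n a' b'"
      "before_eq a' x'" "before_eq y' b'"
    using Suc.prems(2) by (rule nodes_SucE)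
  consider "(a, b) = (a', b')" | "before_eq b a'" | "before_eq b' a"
    using Suc.IH[OF ab(1) ab'(1)] by blast
  then show ?case
  proof cases
    case 1
    then show ?thesis
      using subdivision_linear[OF subdivision_nodes[OF ab(1)] ab(2)] ab'(2) by simp
  next
    case 2
    then show ?thesis using ab(4) ab'(3) before_eq_trans by blast
  next
    case 3
    then show ?thesis using ab'(4) ab(3) before_eq_trans by blast
  qed
qed simp

lemma nodes_ends_Suc:
  assumes "(a, b) \<in> nodes n"
  shows "\<exists>y. (a, y) \<in> nodes (Suc n)" "\<exists>x. (x, b) \<in> nodes (Suc n)"
  using assms subdivision_ends[OF subdivision_nodes[OF assms]] by auto

lemma nodes_left_neighbour:
  "(a, b) \<in> nodes n \<Longrightarrow> 0 < pos a \<Longrightarrow> \<exists>c. (c, a) \<in> nodes n"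
proof (induction n arbitrary: a b)
  case (Suc n)
  obtain a' b' where ab: "(a', b') \<in> nodes n" "(a, b) \<in> children n a' b'"
    using Suc.prems(1) by (rule nodes_SucE)
  have "a = a' \<or> (\<exists>z. (z, a) \<in> children n a' b')"
    by (rule subdivision_member(5)[OF subdivision_nodes[OF ab(1)] ab(2)])
  then show ?case
  proof
    assume "a = a'"
    then show ?thesis using Suc.IH[OF ab(1)] Suc.prems(2) nodes_ends_Suc(2) by blast
  next
    assume "\<exists>z. (z, a) \<in> children n a' b'"
    then show ?thesis using ab(1) by auto
  qed
qed simp

lemma nodes_right_neighbour:
  "(a, b) \<in> nodes n \<Longrightarrow> pos b < 1 \<Longrightarrow> \<exists>c. (b, c) \<in> nodes n"
proof (induction n arbitrary: a b)
  case (Suc n)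
  obtain a' b' where ab: "(a', b') \<in> nodes n" "(a, b) \<in> children n a' b'"
    using Suc.prems(1) by (rule nodes_SucE)
  have "b = b' \<or> (\<exists>z. (b, z) \<in> children n a' b')"
    by (rule subdivision_member(6)[OF subdivision_nodes[OF ab(1)] ab(2)])
  then show ?case
  proof
    assume "b = b'"
    then show ?thesis using Suc.IH[OF ab(1)] Suc.prems(2) nodes_ends_Suc(1) by blast
  next
    assume "\<exists>z. (b, z) \<in> children n a' b'"
    then show ?thesis using ab(1) by auto
  qed
qed simp

lemma nodes_cover: "0 \<le> t \<Longrightarrow> t \<le> 1 \<Longrightarrow> \<exists>a b. (a, b) \<in> nodes n \<and> pos a \<le> t \<and> t \<le> pos b"
proof (induction n)
  case (Suc n)
  then obtain a b where "(a, b) \<in> nodes n" "pos a \<le> t" "t \<le> pos b" by blast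
  then show ?case
    using subdivision_cover[OF subdivision_nodes[of a b n], of t] by auto
qed simp

section \<open>The limiting parameter\<close>

definition knots :: "nat \<Rightarrow> knot set" where
  "knots n = Domain (nodes n) \<union> Range (nodes n)"

lemma knots_mono: "m \<le> n \<Longrightarrow> knots m \<subseteq> knots n"
proof (induction rule: dec_induct)
  case (step n)
  have "knots n \<subseteq> knots (Suc n)"
    unfolding knots_def using nodes_ends_Suc[of _ _ n] by blast
  with step show ?case by blast
qed simp

lemma knots_val_mono:
  assumes "x \<in> knots m" "y \<in> knots n" "pos x \<le> pos y"
  shows "val x \<le> val y"
proof -
  let ?N = "max m n"
  have "x \<in> knots ?N" "y \<in> knots ?N"
    using assms knots_mono[of m ?N] knots_mono[of n ?N] by auto
  then obtain a b a' b' where ab: "(a, b) \<in> nodes ?N" "x = a \<or> x = b"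
    and ab': "(a', b') \<in> nodes ?N" "y = a' \<or> y = b'"
    unfolding knots_def by blast
  have "before a b" "before a' b'"
    using ab ab' nodes_node node_imp_before by blast+
  with nodes_linear[OF ab(1) ab'(1)] ab(2) ab'(2) assms(3) show ?thesis
    by (auto simp: before_def before_eq_def)
qed

lemma knots_range: "x \<in> knots n \<Longrightarrow> 0 \<le> pos x \<and> pos x \<le> 1 \<and> 0 \<le> val x \<and> val x \<le> 1"
proof -
  assume x: "x \<in> knots n"
  have "Knot 0 0 1 \<in> knots 0" "Knot 1 1 1 \<in> knots 0" by (auto simp: knots_def)
  moreover have "0 \<le> pos x \<and> pos x \<le> 1"
    using x nodes_node unfolding knots_def node_def by fastforce
  ultimately show ?thesis
    using x knots_val_mono[of "Knot 0 0 1" 0 x n] knots_val_mono[of x n "Knot 1 1 1" 0] by simp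
qed

text \<open>
  The distribution function of the limiting measure: the monotone function on \<open>[0,1]\<close> that takes
  the value \<open>val x\<close> at the position of each knot \<open>x\<close>.
\<close>

definition param :: "real \<Rightarrow> real" where
  "param t = Sup {val x | x n. x \<in> knots n \<and> pos x \<le> t}"

lemma param_bdd: "bdd_above {val x | x n. x \<in> knots n \<and> pos x \<le> t}"
  by (rule bdd_aboveI[of _ 1]) (use knots_range in auto)

lemma param_knot:
  assumes "x \<in> knots n"
  shows "param (pos x) = val x"
  unfolding param_def
  by (rule cSup_eq_maximum) (use assms knots_val_mono in auto)

lemma param_mono:
  assumes "0 \<le> s" "s \<le> t"
  shows "param s \<le> param t"
  unfolding param_def
proof (rule cSup_subset_mono)
  have "Knot 0 0 1 \<in> knots 0" by (auto simp: knots_def)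
  then show "{val x | x n. x \<in> knots n \<and> pos x \<le> s} \<noteq> {}" using assms by force
  show "{val x | x n. x \<in> knots n \<and> pos x \<le> s} \<subseteq> {val x | x n. x \<in> knots n \<and> pos x \<le> t}"
    using assms by force
qed (rule param_bdd)

lemma param_node:
  assumes "(a, b) \<in> nodes n"
  shows "param (pos a) = val a" "param (pos b) = val b"
  using assms by (auto intro!: param_knot[of _ n] simp: knots_def)

lemma param_0: "param 0 = 0" and param_1: "param 1 = 1"
  using param_node[of "Knot 0 0 1" "Knot 1 1 1" 0] by simp_all

text \<open>Both weights are within a factor 2 above the weight that the common knot prescribes.\<close>

lemma neighbour_ratio:
  assumes "(a, b) \<in> nodes n" "(b, c) \<in> nodes n"
  shows "val b - val a \<le> 2 * (val c - val b)" "val c - val b \<le> 2 * (val b - val a)"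
proof -
  have *: "(val b - val a) / 2 \<le> local_weight b / 16 ^ n" "local_weight b / 16 ^ n \<le> val b - val a"
    "(val c - val b) / 2 \<le> local_weight b / 16 ^ n" "local_weight b / 16 ^ n \<le> val c - val b"
    using nodes_node[OF assms(1)] nodes_node[OF assms(2)] unfolding node_def by blast+
  show "val b - val a \<le> 2 * (val c - val b)"
    using order_trans[OF *(1,4)] by simp
  show "val c - val b \<le> 2 * (val b - val a)"
    using order_trans[OF *(3,2)] by simp
qed

text \<open>The size of the segment between two points in either order.\<close>

definition segment_size :: "real \<Rightarrow> real \<Rightarrow> real" where
  "segment_size s t = d (min s t) (max s t)"

text \<open>
  A segment smaller than \<open>mesh n\<close> contains no node of level \<open>n\<close>. So if it starts in the node
  \<open>(a, b)\<close>, then it ends there or in a neighbour, whose weight is at most twice that of \<open>(a, b)\<close>.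
\<close>

lemma param_diff_upper:
  assumes ab: "(a, b) \<in> nodes n" "pos a \<le> y" "y \<le> pos b" and z: "0 \<le> z" "z \<le> 1"
    and small: "segment_size y z < mesh n"
  shows "\<bar>param y - param z\<bar> \<le> 3 * (val b - val a)"
proof -
  have N: "node n a b" using nodes_node[OF ab(1)] .
  have y: "val a \<le> param y" "param y \<le> val b"
    using param_mono[of "pos a" y] param_mono[of y "pos b"] param_node[OF ab(1)] ab N
    by (auto simp: node_def)
  consider "pos a \<le> z" "z \<le> pos b" | "z < pos a" | "pos b < z" by linarith
  then show ?thesis
  proof cases
    case 1
    then have "val a \<le> param z" "param z \<le> val b"
      using param_mono[of "pos a" z] param_mono[of z "pos b"] param_node[OF ab(1)] z N
      by (auto simp: node_def)
    then show ?thesis using y N by (auto simp: node_def)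
  next
    case 2
    then obtain c where c: "(c, a) \<in> nodes n"
      using nodes_left_neighbour[OF ab(1)] z by force
    have Nc: "node n c a" using nodes_node[OF c] .
    have "pos c \<le> z"
    proof (rule ccontr)
      assume "\<not> pos c \<le> z"
      then have "mesh n \<le> d z y"
        using Nc N size_mono[of z "pos c" "pos a" y] z ab by (auto simp: node_def)
      then show False using small 2 ab by (simp add: segment_size_def)
    qed
    then have "val c \<le> param z" "param z \<le> param y"
      using param_mono[of "pos c" z] param_mono[of z y] param_node[OF c] z 2 ab Nc
      by (auto simp: node_def)
    then show ?thesis using y neighbour_ratio[OF c ab(1)] by simp
  next
    case 3
    then obtain c where c: "(b, c) \<in> nodes n"
      using nodes_right_neighbour[OF ab(1)] z by force
    have Nc: "node n b c" using nodes_node[OF c] .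
    have "z \<le> pos c"
    proof (rule ccontr)
      assume "\<not> z \<le> pos c"
      then have "mesh n \<le> d y z"
        using Nc N size_mono[of y "pos b" "pos c" z] z ab by (auto simp: node_def)
      then show False using small 3 ab by (simp add: segment_size_def)
    qed
    then have "param z \<le> val c" "param y \<le> param z"
      using param_mono[of z "pos c"] param_mono[of y z] param_node[OF c] z 3 ab N
      by (auto simp: node_def)
    then show ?thesis using y neighbour_ratio[OF ab(1) c] by simp
  qed
qed

text \<open>
  Two neighbouring nodes together have size at most \<open>4 * mesh n\<close>. So a larger segment that starts
  in \<open>(a, b)\<close> contains one of its neighbours, whose weight is at least half that of \<open>(a, b)\<close>.
\<close>

lemma param_diff_lower:
  assumes ab: "(a, b) \<in> nodes n" "pos a \<le> y" "y \<le> pos b" and z: "0 \<le> z" "z \<le> 1"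
    and large: "4 * mesh n < segment_size y z"
  shows "(val b - val a) / 2 \<le> \<bar>param y - param z\<bar>"
proof -
  have N: "node n a b" using nodes_node[OF ab(1)] .
  have y: "val a \<le> param y" "param y \<le> val b"
    using param_mono[of "pos a" y] param_mono[of y "pos b"] param_node[OF ab(1)] ab N
    by (auto simp: node_def)
  have "\<not> (pos a \<le> z \<and> z \<le> pos b)"
  proof
    assume "pos a \<le> z \<and> z \<le> pos b"
    then have "segment_size y z \<le> d (pos a) (pos b)"
      unfolding segment_size_def using ab N by (intro size_mono) (auto simp: node_def)
    then show False using large N mesh_pos[of n] by (simp add: node_def)
  qed
  then consider "z < pos a" | "pos b < z" by linarith
  then show ?thesis
  proof cases
    case 1
    then obtain c where c: "(c, a) \<in> nodes n"
      using nodes_left_neighbour[OF ab(1)] z by force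
    have Nc: "node n c a" using nodes_node[OF c] .
    have "z \<le> pos c"
    proof (rule ccontr)
      assume "\<not> z \<le> pos c"
      then have "d z y \<le> d (pos c) (pos b)"
        using Nc N 1 ab by (intro size_mono) (auto simp: node_def)
      also have "\<dots> \<le> d (pos c) (pos a) + d (pos a) (pos b)"
        using Nc N by (intro size_triangle) (auto simp: node_def)
      finally show False using large Nc N 1 ab by (simp add: segment_size_def node_def)
    qed
    then have "param z \<le> val c"
      using param_mono[of z "pos c"] param_node[OF c] z by simp
    then show ?thesis using y neighbour_ratio[OF c ab(1)] by simp
  next
    case 2
    then obtain c where c: "(b, c) \<in> nodes n"
      using nodes_right_neighbour[OF ab(1)] z by force
    have Nc: "node n b c" using nodes_node[OF c] .
    have "pos c \<le> z"
    proof (rule ccontr)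
      assume "\<not> pos c \<le> z"
      then have "d y z \<le> d (pos a) (pos c)"
        using Nc N 2 ab by (intro size_mono) (auto simp: node_def)
      also have "\<dots> \<le> d (pos a) (pos b) + d (pos b) (pos c)"
        using Nc N by (intro size_triangle) (auto simp: node_def)
      finally show False using large Nc N 2 ab by (simp add: segment_size_def node_def)
    qed
    then have "val c \<le> param z"
      using param_mono[of "pos c" z] param_node[OF c] Nc by (auto simp: node_def)
    then show ?thesis using y neighbour_ratio[OF ab(1) c] by simp
  qed
qed

lemma segment_size_pos: "\<lbrakk>s \<in> {0..1}; t \<in> {0..1}; s \<noteq> t\<rbrakk> \<Longrightarrow> 0 < segment_size s t"
  unfolding segment_size_def by (intro size_pos) auto

lemma param_strict_mono:
  assumes "0 \<le> s" "s < t" "t \<le> 1"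
  shows "param s < param t"
proof -
  have "0 < segment_size s t" using assms by (intro segment_size_pos) auto
  then obtain n where n: "mesh n < segment_size s t / 4"
    using mesh_small[of "segment_size s t / 4"] by auto
  obtain a b where ab: "(a, b) \<in> nodes n" "pos a \<le> s" "s \<le> pos b"
    using nodes_cover[of s n] assms by auto
  have "(val b - val a) / 2 \<le> \<bar>param s - param t\<bar>"
    using param_diff_lower[OF ab, of t] n assms by simp
  moreover have "val a < val b" using nodes_node[OF ab(1)] by (simp add: node_def)
  ultimately show ?thesis using param_mono[of s t] assms by simp
qed

lemma param_continuous: "continuous_on {0..1} param"
  unfolding continuous_on_iff
proof (intro ballI allI impI)
  fix y e :: real
  assume y: "y \<in> {0..1}" and e: "0 < e"
  obtain n where n: "(1/8) ^ n < e / 3"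
    using real_arch_pow_inv[of "e / 3" "1/8"] e by auto
  obtain a b where ab: "(a, b) \<in> nodes n" "pos a \<le> y" "y \<le> pos b"
    using nodes_cover[of y n] y by auto
  obtain \<eta> where \<eta>: "0 < \<eta>" "\<And>s t. \<lbrakk>0 \<le> s; s \<le> t; t \<le> 1; t - s < \<eta>\<rbrakk> \<Longrightarrow> d s t < mesh n"
    using size_small[OF mesh_pos[of n]] by blast
  show "\<exists>\<delta>>0. \<forall>z\<in>{0..1}. dist z y < \<delta> \<longrightarrow> dist (param z) (param y) < e"
  proof (intro exI[of _ \<eta>] conjI ballI impI \<eta>(1))
    fix z assume z: "z \<in> {0..1}" "dist z y < \<eta>"
    then have "segment_size y z < mesh n"
      unfolding segment_size_def using y by (intro \<eta>(2)) (auto simp: dist_real_def)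
    then have "\<bar>param y - param z\<bar> \<le> 3 * (val b - val a)"
      using param_diff_upper[OF ab] z by auto
    also have "\<dots> < e" using nodes_weight[OF ab(1)] n by simp
    finally show "dist (param z) (param y) < e" by (simp add: dist_real_def abs_minus_commute)
  qed
qed

lemma param_image: "param ` {0..1} = {0..1}"
proof
  show "param ` {0..1} \<subseteq> {0..1}"
    using param_mono param_0 param_1 by fastforce
  show "{0..1} \<subseteq> param ` {0..1}"
    using IVT'[of param 0 _ 1] param_continuous param_0 param_1 by fastforce
qed

lemma param_homeomorphism: "\<exists>q. homeomorphism {0..1} {0..1} param q"
proof (rule homeomorphism_compact)
  show "inj_on param {0..1}"
    using param_strict_mono by (fastforce intro!: linorder_inj_onI)
qed (use param_continuous param_image in auto)

text \<open>
  The constant is \<open>4 * 128 ^ 2\<close>: the size of the segment from \<open>x\<close> to \<open>y\<close> is at most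
  \<open>4 * mesh k\<close>, where \<open>k\<close> is the level before the one at which that segment is compared with a
  node, and the segment from \<open>x\<close> to \<open>z\<close> is compared with a node of level \<open>k + 2\<close>.
\<close>

lemma param_weak_quasisymmetric:
  assumes x: "x \<in> {0..1}" and y: "y \<in> {0..1}" and z: "z \<in> {0..1}"
    and le: "\<bar>param x - param y\<bar> \<le> \<bar>param x - param z\<bar>"
  shows "segment_size x y \<le> 65536 * segment_size x z"
proof (rule ccontr)
  assume "\<not> segment_size x y \<le> 65536 * segment_size x z"
  then have big: "65536 * segment_size x z < segment_size x y" by simp
  have nonneg: "0 \<le> segment_size x z"
    using segment_size_pos[of x z] x z size_refl[of x] by (cases "x = z") (auto simp: segment_size_def)
  then obtain n where "mesh n < segment_size x y / 4"
    using mesh_small[of "segment_size x y / 4"] big by auto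
  then have ex: "\<exists>n. 4 * mesh n < segment_size x y"
    by (intro exI[of _ n]) linarith
  define m where "m = (LEAST n. 4 * mesh n < segment_size x y)"
  have m: "4 * mesh m < segment_size x y"
    unfolding m_def using ex by (rule LeastI_ex)
  have "segment_size x y \<le> mesh 0"
    unfolding segment_size_def mesh_def using x y size_mono[of 0 "min x y" "max x y" 1] by simp
  with m mesh_pos[of 0] have "m \<noteq> 0" by (intro notI) simp
  then obtain k where k: "m = Suc k" using not0_implies_Suc by blast
  then have "segment_size x y \<le> 4 * mesh k"
    using not_less_Least[of k "\<lambda>n. 4 * mesh n < segment_size x y"] by (simp add: m_def)
  then have small: "segment_size x z < mesh (Suc m)"
    using big mesh_Suc[of k] mesh_Suc[of m] k by simp
  obtain a b where ab: "(a, b) \<in> nodes (Suc m)" "pos a \<le> x" "x \<le> pos b"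
    using nodes_cover[of x "Suc m"] x by auto
  obtain a' b' where ab': "(a', b') \<in> nodes m" "before_eq a' a" "before_eq b b'"
      "val b - val a \<le> (val b' - val a') / 8"
    using ab(1) by (rule nodes_SucE)
  have "\<bar>param x - param z\<bar> \<le> 3 * (val b - val a)"
    using param_diff_upper[OF ab _ _ small] z by simp
  moreover have "(val b' - val a') / 2 \<le> \<bar>param x - param y\<bar>"
    using param_diff_lower[OF ab'(1) _ _ _ _ m] y ab ab'(2,3)[THEN before_eq_imp_le] by simp
  moreover have "val a' < val b'" using nodes_node[OF ab'(1)] by (simp add: node_def)
  ultimately show False using le ab'(4) by simp
qed

end

section \<open>Bounded turning and weak quasisymmetry\<close>

lemma diameter_leI:
  assumes "S \<noteq> {}" "\<And>x y. \<lbrakk>x \<in> S; y \<in> S\<rbrakk> \<Longrightarrow> dist x y \<le> e"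
  shows "diameter S \<le> e"
  unfolding diameter_def using assms by (auto intro!: cSUP_least)

lemma arc_size_diameter:
  fixes g :: "real \<Rightarrow> 'a::metric_space"
  assumes cont: "continuous_on {0..1} g" and inj: "inj_on g {0..1}"
  shows "arc_size (\<lambda>s t. diameter (g ` {s..t}))"
proof
  have bdd: "bounded (g ` {s..t})" if "0 \<le> s" "t \<le> 1" for s t
    using that by (intro compact_imp_bounded compact_continuous_image continuous_on_subset[OF cont]) auto
  fix s t u s' t' :: real
  show "diameter (g ` {s'..t'}) \<le> diameter (g ` {s..t})"
    if "0 \<le> s" "s \<le> s'" "s' \<le> t'" "t' \<le> t" "t \<le> 1"
    using that bdd by (intro diameter_subset image_mono) auto
  show "diameter (g ` {s..u}) \<le> diameter (g ` {s..t}) + diameter (g ` {t..u})"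
    if stu: "0 \<le> s" "s \<le> t" "t \<le> u" "u \<le> 1"
  proof (rule diameter_leI)
    have left: "dist (g v) (g w) \<le> diameter (g ` {s..t})" if "v \<in> {s..t}" "w \<in> {s..t}" for v w
      using that stu bdd by (intro diameter_bounded_bound) auto
    have right: "dist (g v) (g w) \<le> diameter (g ` {t..u})" if "v \<in> {t..u}" "w \<in> {t..u}" for v w
      using that stu bdd by (intro diameter_bounded_bound) auto
    have nonneg: "0 \<le> diameter (g ` {s..t})" "0 \<le> diameter (g ` {t..u})"
      using left[of t t] right[of t t] stu by auto
    have ordered: "dist (g v) (g w) \<le> diameter (g ` {s..t}) + diameter (g ` {t..u})"
      if "s \<le> v" "v \<le> w" "w \<le> u" for v w
    proof (cases "w \<le> t \<or> t \<le> v")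
      case True
      then show ?thesis using left[of v w] right[of v w] nonneg that by auto
    next
      case False
      then show ?thesis
        using left[of v t] right[of t w] dist_triangle[of "g v" "g w" "g t"] that by auto
    qed
    fix x y assume "x \<in> g ` {s..u}" "y \<in> g ` {s..u}"
    then obtain v w where "v \<in> {s..u}" "w \<in> {s..u}" "x = g v" "y = g w" by blast
    then show "dist x y \<le> diameter (g ` {s..t}) + diameter (g ` {t..u})"
      using ordered[of v w] ordered[of w v] by (cases "v \<le> w") (auto simp: dist_commute)
  qed (use stu in auto)
  show "0 < diameter (g ` {s..t})" if "0 \<le> s" "s < t" "t \<le> 1"
  proof -
    have "0 < dist (g s) (g t)"
      using inj_onD[OF inj, of s t] that by auto
    also have "\<dots> \<le> diameter (g ` {s..t})"
      using that bdd by (intro diameter_bounded_bound) auto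
    finally show ?thesis .
  qed
next
  fix e :: real assume e: "0 < e"
  have "uniformly_continuous_on {0..1} g"
    using cont by (rule compact_uniformly_continuous) simp
  then obtain \<eta> where \<eta>: "0 < \<eta>"
    "\<And>v w. \<lbrakk>v \<in> {0..1}; w \<in> {0..1}; dist v w < \<eta>\<rbrakk> \<Longrightarrow> dist (g v) (g w) < e / 2"
    using e unfolding uniformly_continuous_on_def by (metis half_gt_zero)
  have "diameter (g ` {s..t}) < e" if "0 \<le> s" "s \<le> t" "t \<le> 1" "t - s < \<eta>" for s t
  proof -
    have "diameter (g ` {s..t}) \<le> e / 2"
    proof (rule diameter_leI)
      fix x y assume "x \<in> g ` {s..t}" "y \<in> g ` {s..t}"
      then obtain v w where "v \<in> {s..t}" "w \<in> {s..t}" "x = g v" "y = g w" by blast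
      moreover from this have "dist v w < \<eta>"
        using that by (auto simp: dist_real_def)
      ultimately show "dist x y \<le> e / 2"
        using \<eta>(2)[of v w] that by simp
    qed (use that in auto)
    with e show ?thesis by simp
  qed
  with \<eta>(1) show "\<exists>\<eta>>0. \<forall>s t. 0 \<le> s \<longrightarrow> s \<le> t \<longrightarrow> t \<le> 1 \<longrightarrow> t - s < \<eta> \<longrightarrow> diameter (g ` {s..t}) < e"
    by blast
qed

lemma bounded_turning_imp_weak_quasisymmetric:
  fixes A :: "'a::metric_space set"
  assumes arc: "metric_jordan_arc A" and turning: "bounded_turning A"
  shows "\<exists>\<phi>. weak_quasisymmetric_homeomorphism {0..1::real} A \<phi>"
proof -
  obtain g h where gh: "homeomorphism {0..1::real} A g h"
    using arc homeomorphic_sym unfolding metric_jordan_arc_def homeomorphic_def by blast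
  obtain C where C: "1 \<le> C" "\<And>x y. \<lbrakk>x \<in> A; y \<in> A\<rbrakk> \<Longrightarrow> diameter (subarc A x y) \<le> C * dist x y"
    using turning unfolding bounded_turning_def by blast
  have g: "continuous_on {0..1} g" "inj_on g {0..1}" "g ` {0..1} = A"
    using gh by (auto simp: homeomorphism_def intro: inj_on_inverseI)
  interpret arc_size "\<lambda>s t. diameter (g ` {s..t})"
    using g(1,2) by (rule arc_size_diameter)
  obtain q where q: "homeomorphism {0..1} {0..1} param q"
    using param_homeomorphism by blast
  have size: "dist (g s) (g t) \<le> segment_size s t" "segment_size s t \<le> C * dist (g s) (g t)"
    if "s \<in> {0..1}" "t \<in> {0..1}" for s t
  proof -
    have seg: "{min s t..max s t} = closed_segment s t"
      by (auto simp: closed_segment_eq_real_ivl)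
    have "closed_segment s t \<subseteq> {0..1}"
      using that by (intro closed_segment_subset) auto
    then have "compact (g ` closed_segment s t)"
      by (intro compact_continuous_image continuous_on_subset[OF g(1)]) auto
    then show "dist (g s) (g t) \<le> segment_size s t"
      unfolding segment_size_def seg by (intro diameter_bounded_bound compact_imp_bounded) auto
    have "g s \<in> A" "g t \<in> A" using that g(3) by auto
    then show "segment_size s t \<le> C * dist (g s) (g t)"
      using C(2)[of "g s" "g t"] subarc_eq[OF gh, of "g s" "g t"] homeomorphism_apply1[OF gh] that
      unfolding segment_size_def seg by simp
  qed
  have "weak_quasisymmetric_homeomorphism {0..1} A (g \<circ> q)"
    unfolding weak_quasisymmetric_homeomorphism_def
  proof (intro conjI exI)
    show "homeomorphism {0..1} A (g \<circ> q) (param \<circ> h)"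
      using homeomorphism_compose[OF _ gh] q homeomorphism_symD by blast
    show "1 \<le> 65536 * C" using C(1) by simp
    show "\<forall>x\<in>{0..1}. \<forall>y\<in>{0..1}. \<forall>z\<in>{0..1}. dist x y \<le> dist x z \<longrightarrow>
        dist ((g \<circ> q) x) ((g \<circ> q) y) \<le> 65536 * C * dist ((g \<circ> q) x) ((g \<circ> q) z)"
    proof (intro ballI impI)
      fix x y z :: real
      assume xyz: "x \<in> {0..1}" "y \<in> {0..1}" "z \<in> {0..1}" and le: "dist x y \<le> dist x z"
      have mem: "q x \<in> {0..1}" "q y \<in> {0..1}" "q z \<in> {0..1}"
        using homeomorphism_image2[OF q] xyz by blast+
      have "param (q x) = x" "param (q y) = y" "param (q z) = z"
        using homeomorphism_apply2[OF q] xyz by auto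
      then have "segment_size (q x) (q y) \<le> 65536 * segment_size (q x) (q z)"
        using param_weak_quasisymmetric[OF mem] le by (simp add: dist_real_def)
      then show "dist ((g \<circ> q) x) ((g \<circ> q) y) \<le> 65536 * C * dist ((g \<circ> q) x) ((g \<circ> q) z)"
        using size(1)[OF mem(1,2)] size(2)[OF mem(1,3)] by simp
    qed
  qed
  then show ?thesis by blast
qed

lemma weak_quasisymmetric_imp_bounded_turning:
  fixes A :: "'a::metric_space set"
  assumes "weak_quasisymmetric_homeomorphism {0..1::real} A \<phi>"
  shows "bounded_turning A"
proof -
  obtain \<psi> H where hom: "homeomorphism {0..1} A \<phi> \<psi>" and H: "1 \<le> H"
    "\<And>x y z. \<lbrakk>x \<in> {0..1}; y \<in> {0..1}; z \<in> {0..1}; dist x y \<le> dist x z\<rbrakk>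
      \<Longrightarrow> dist (\<phi> x) (\<phi> y) \<le> H * dist (\<phi> x) (\<phi> z)"
    using assms unfolding weak_quasisymmetric_homeomorphism_def by metis
  have "diameter (subarc A x y) \<le> 2 * H * dist x y" if xy: "x \<in> A" "y \<in> A" for x y
    unfolding subarc_eq[OF hom xy]
  proof (rule diameter_leI)
    have mem: "\<psi> x \<in> {0..1}" "\<psi> y \<in> {0..1}"
      using homeomorphism_image2[OF hom] xy by blast+
    have near: "dist x (\<phi> s) \<le> H * dist x y" if "s \<in> closed_segment (\<psi> x) (\<psi> y)" for s
    proof -
      have "dist (\<psi> x) s \<le> dist (\<psi> x) (\<psi> y)"
        using that by (auto simp: dist_real_def closed_segment_eq_real_ivl split: if_splits)
      moreover have "s \<in> {0..1}"
        using that mem by (auto simp: closed_segment_eq_real_ivl split: if_splits)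
      ultimately show ?thesis
        using H(2)[of "\<psi> x" s "\<psi> y"] mem homeomorphism_apply2[OF hom] xy by simp
    qed
    fix v w assume "v \<in> \<phi> ` closed_segment (\<psi> x) (\<psi> y)" "w \<in> \<phi> ` closed_segment (\<psi> x) (\<psi> y)"
    then obtain s t where "s \<in> closed_segment (\<psi> x) (\<psi> y)" "v = \<phi> s"
      "t \<in> closed_segment (\<psi> x) (\<psi> y)" "w = \<phi> t" by blast
    then show "dist v w \<le> 2 * H * dist x y"
      using near[of s] near[of t] dist_triangle3[of v w x] by simp
  qed auto
  with H(1) show ?thesis
    unfolding bounded_turning_def by (intro exI[of _ "2 * H"]) auto
qed

theorem corollary1p2:
  fixes A :: "'a::metric_space set"
  assumes "metric_jordan_arc A"
  shows "bounded_turning A \<longleftrightarrow>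
    (\<exists>\<phi>. weak_quasisymmetric_homeomorphism {0..1::real} A \<phi>)"
  using bounded_turning_imp_weak_quasisymmetric[OF assms] weak_quasisymmetric_imp_bounded_turning
  by blast

end
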